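(* Let $(X,d)$ be a geodesic $\delta$-hyperbolic metric space, $\delta\ge 0$. For any $\mu,\nu\in\mathcal{P}^1(X)$, $x\in\mathcal{B}(\mu,\varepsilon_1)$ and $y\in\mathcal{B}(\nu,\varepsilon_2)$ with $\varepsilon_1,\varepsilon_2\ge 0$, we have \[ d(x,y)\le W_1(\mu,\nu)+\max\left\{8\delta,\ \sqrt{54\,D_2\sqrt{D_2+\delta}\,\sqrt{\delta}+3(\varepsilon_1+\varepsilon_2)}\right\}, \] where $D_2=D_2(x,y,\mu,\nu):=\operatorname{diam}\big(\{x,y\}\cup\operatorname{supp}\mu\cup\operatorname{supp}\nu\big)$ is the diameter with respect to $d$.
   Context: A metric space $(X,d)$ is $\delta$-hyperbolic if $(x|z)_p\ge\min\{(x|y)_p,(y|z)_p\}-\delta$ for all $p,x,y,z\in X$, where $(x|y)_p:=\frac12\{d(p,x)+d(p,y)-d(x,y)\}$. It is geodesic if any two points $x,y$ are joined by a minimal geodesic $\gamma:[0,1]\to X$, i.e. $\gamma(0)=x$, $\gamma(1)=y$ and $d(\gamma(s),\gamma(t))=|s-t|\,d(x,y)$ for all $s,t\in[0,1]$. $\mathcal{P}^1(X)$ is the set of Borel probability measures $\mu$ on $X$ with $\int_X d(x_0,x)\,\mu(dx)<\infty$ for some (hence any) $x_0\in X$. For $\mu,\nu\in\mathcal{P}^1(X)$, $W_1(\mu,\nu):=\inf_\pi\int_{X\times X}d(x,y)\,\pi(dx\,dy)$, where $\pi$ runs over all couplings of $(\mu,\nu)$ (probability measures on $X\times X$ with marginals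 $\mu$ and $\nu$). For $\mu\in\mathcal{P}^1(X)$ and $\varepsilon\ge 0$, the barycentric set is \[ \mathcal{B}(\mu,\varepsilon):=\left\{x\in X\ \middle|\ \int_X\{d^2(x,z)-d^2(x_0,z)\}\,\mu(dz)\le\inf_{y\in X}\int_X\{d^2(y,z)-d^2(x_0,z)\}\,\mu(dz)+\varepsilon\right\}, \] which does not depend on the choice of the point $x_0\in X$. Here $d^2(x,z)$ means $d(x,z)^2$.
   Formalization: The measures μ and ν are assumed to be carried by their supports (supp μ and supp ν have full measure); this is automatic when X is separable, but in a non-separable X a smallest closed set of full measure need not exist. *)

theory Defs
  imports "HOL-Probability.Probability"
begin

definition gromov_product :: "'a::metric_space \<Rightarrow> 'a \<Rightarrow> 'a \<Rightarrow> real" where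
  "gromov_product p x y = (dist p x + dist p y - dist x y) / 2"

definition delta_hyperbolic :: "'a::metric_space itself \<Rightarrow> real \<Rightarrow> bool" where
  "delta_hyperbolic _ \<delta> \<longleftrightarrow>
     (\<forall>p x y z :: 'a. gromov_product p x z \<ge> min (gromov_product p x y) (gromov_product p y z) - \<delta>)"

definition minimal_geodesic :: "(real \<Rightarrow> 'a::metric_space) \<Rightarrow> 'a \<Rightarrow> 'a \<Rightarrow> bool" where
  "minimal_geodesic \<gamma> x y \<longleftrightarrow>
     \<gamma> 0 = x \<and> \<gamma> 1 = y \<and> (\<forall>s\<in>{0..1}. \<forall>t\<in>{0..1}. dist (\<gamma> s) (\<gamma> t) = \<bar>s - t\<bar> * dist x y)"

definition geodesic_space :: "'a::metric_space itself \<Rightarrow> bool" where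
  "geodesic_space _ \<longleftrightarrow> (\<forall>x y :: 'a. \<exists>\<gamma>. minimal_geodesic \<gamma> x y)"

definition P1 :: "'a::metric_space measure set" where
  "P1 = {\<mu>. prob_space \<mu> \<and> sets \<mu> = sets borel \<and> (\<exists>x0. integrable \<mu> (\<lambda>x. dist x0 x))}"

text \<open>Couplings are Borel measures for the product topology. For a separable space this is the
  product of the Borel sigma-algebras; in general it can be finer, and it is the one for which the
  distance function is measurable.\<close>

definition couplings :: "'a::metric_space measure \<Rightarrow> 'a measure \<Rightarrow> ('a \<times> 'a) measure set" where
  "couplings \<mu> \<nu> = {\<pi>. prob_space \<pi> \<and> sets \<pi> = sets borel \<and>
     distr \<pi> borel fst = \<mu> \<and> distr \<pi> borel snd = \<nu>}"

definition W1 :: "'a::metric_space measure \<Rightarrow> 'a measure \<Rightarrow> ennreal" where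
  "W1 \<mu> \<nu> = (INF \<pi>\<in>couplings \<mu> \<nu>. \<integral>\<^sup>+ p. ennreal (dist (fst p) (snd p)) \<partial>\<pi>)"

definition bary_functional :: "'a::metric_space measure \<Rightarrow> 'a \<Rightarrow> 'a \<Rightarrow> real" where
  "bary_functional \<mu> x0 x = (\<integral>z. ((dist x z)\<^sup>2 - (dist x0 z)\<^sup>2) \<partial>\<mu>)"

text \<open>The base point \<open>x0\<close> is immaterial, see \<open>barycentric_set_iff\<close> below, and the infimum is over
  a set that is bounded below, see \<open>bary_functional_bdd_below\<close>.\<close>

definition barycentric_set :: "'a::metric_space measure \<Rightarrow> real \<Rightarrow> 'a set" where
  "barycentric_set \<mu> \<epsilon> =
     {x. \<exists>x0. bary_functional \<mu> x0 x \<le> (INF y. bary_functional \<mu> x0 y) + \<epsilon>}"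

definition msupport :: "'a::topological_space measure \<Rightarrow> 'a set" where
  "msupport \<mu> = {x. \<forall>U. open U \<and> x \<in> U \<longrightarrow> emeasure \<mu> U > 0}"

text \<open>Unlike \<^const>\<open>diameter\<close>, this is infinite on unbounded sets. Products with it follow the
  \<^typ>\<open>ennreal\<close> convention \<open>top * 0 = 0\<close>.\<close>

definition ediam :: "'a::metric_space set \<Rightarrow> ennreal" where
  "ediam A = (SUP p\<in>A \<times> A. ennreal (dist (fst p) (snd p)))"

definition ennsqrt :: "ennreal \<Rightarrow> ennreal" where
  "ennsqrt a = (if a = top then top else ennreal (sqrt (enn2real a)))"

lemma P1_integrable_dist:
  fixes \<mu> :: "'a::metric_space measure"
  assumes "\<mu> \<in> P1"
  shows "integrable \<mu> (\<lambda>z. dist x z)"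
proof -
  from assms obtain x0 where p: "prob_space \<mu>" and s[measurable_cong]: "sets \<mu> = sets borel"
    and i: "integrable \<mu> (\<lambda>z. dist x0 z)" by (auto simp: P1_def)
  interpret prob_space \<mu> by fact
  have m: "(\<lambda>z. dist x z) \<in> borel_measurable \<mu>"
    unfolding measurable_cong_sets[OF s refl]
    by (intro borel_measurable_continuous_onI continuous_intros)
  have "integrable \<mu> (\<lambda>z. dist x x0 + dist x0 z)" using i by simp
  then show ?thesis
    by (rule Bochner_Integration.integrable_bound[OF _ m]) (simp add: dist_triangle)
qed

lemma P1_integrable_dist_sq_diff:
  fixes \<mu> :: "'a::metric_space measure"
  assumes "\<mu> \<in> P1"
  shows "integrable \<mu> (\<lambda>z. (dist x z)\<^sup>2 - (dist y z)\<^sup>2)"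
proof -
  have s: "sets \<mu> = sets borel" using assms by (auto simp: P1_def)
  have m: "(\<lambda>z. (dist x z)\<^sup>2 - (dist y z)\<^sup>2) \<in> borel_measurable \<mu>"
    unfolding measurable_cong_sets[OF s refl]
    by (intro borel_measurable_continuous_onI continuous_intros)
  have "integrable \<mu> (\<lambda>z. dist x y * (dist x z + dist y z))"
    using P1_integrable_dist[OF assms] by simp
  then show ?thesis
  proof (rule Bochner_Integration.integrable_bound[OF _ m], intro always_eventually allI)
    fix z
    have "\<bar>dist x z - dist y z\<bar> \<le> dist x y"
      using dist_triangle[of x z y] dist_triangle3[of y z x] by (simp add: dist_commute abs_le_iff)
    then have "\<bar>dist x z - dist y z\<bar> * (dist x z + dist y z) \<le> dist x y * (dist x z + dist y z)"
      by (intro mult_right_mono) auto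
    moreover have "(dist x z)\<^sup>2 - (dist y z)\<^sup>2 = (dist x z - dist y z) * (dist x z + dist y z)"
      by (simp add: power2_eq_square algebra_simps)
    ultimately show "norm ((dist x z)\<^sup>2 - (dist y z)\<^sup>2) \<le> norm (dist x y * (dist x z + dist y z))"
      by (simp add: abs_mult)
  qed
qed

lemma bary_functional_bdd_below:
  fixes \<mu> :: "'a::metric_space measure"
  assumes "\<mu> \<in> P1"
  shows "bdd_below (range (bary_functional \<mu> x0))"
proof -
  interpret prob_space \<mu> using assms by (simp add: P1_def)
  define M where "M = (\<integral>z. dist x0 z \<partial>\<mu>)"
  have "bary_functional \<mu> x0 y \<ge> - M\<^sup>2" for y
  proof -
    have "(dist x0 y)\<^sup>2 - 2 * dist x0 y * dist x0 z \<le> (dist y z)\<^sup>2 - (dist x0 z)\<^sup>2" for z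
    proof -
      have "\<bar>dist x0 y - dist x0 z\<bar> \<le> dist y z"
        using dist_triangle[of x0 y z] dist_triangle[of x0 z y] by (simp add: dist_commute abs_le_iff)
      then have "\<bar>dist x0 y - dist x0 z\<bar>\<^sup>2 \<le> (dist y z)\<^sup>2" by (intro power_mono) auto
      then show ?thesis by (simp add: power2_eq_square algebra_simps)
    qed
    then have "(\<integral>z. ((dist x0 y)\<^sup>2 - 2 * dist x0 y * dist x0 z) \<partial>\<mu>) \<le> bary_functional \<mu> x0 y"
      unfolding bary_functional_def
      by (intro integral_mono P1_integrable_dist_sq_diff[OF assms])
         (use P1_integrable_dist[OF assms] in auto)
    moreover have "(\<integral>z. ((dist x0 y)\<^sup>2 - 2 * dist x0 y * dist x0 z) \<partial>\<mu>) = (dist x0 y)\<^sup>2 - 2 * dist x0 y * M"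
      using P1_integrable_dist[OF assms] by (simp add: M_def prob_space)
    moreover have "(dist x0 y)\<^sup>2 - 2 * dist x0 y * M \<ge> - M\<^sup>2"
      using zero_le_power2[of "dist x0 y - M"] by (simp add: power2_eq_square algebra_simps)
    ultimately show ?thesis by linarith
  qed
  then show ?thesis by (intro bdd_belowI2)
qed

lemma barycentric_set_iff:
  fixes \<mu> :: "'a::metric_space measure"
  assumes "\<mu> \<in> P1"
  shows "x \<in> barycentric_set \<mu> \<epsilon> \<longleftrightarrow>
    bary_functional \<mu> x0 x \<le> (INF y. bary_functional \<mu> x0 y) + \<epsilon>"
proof -
  have shift: "bary_functional \<mu> b y = bary_functional \<mu> b a + bary_functional \<mu> a y" for a b y
    unfolding bary_functional_def
    using P1_integrable_dist_sq_diff[OF assms]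
    by (subst Bochner_Integration.integral_add[symmetric]) auto
  have "bary_functional \<mu> x0 x \<le> (INF y. bary_functional \<mu> x0 y) + \<epsilon>"
    if "bary_functional \<mu> x1 x \<le> (INF y. bary_functional \<mu> x1 y) + \<epsilon>" for x1
  proof -
    have "bary_functional \<mu> x0 x - \<epsilon> \<le> bary_functional \<mu> x0 y" for y
    proof -
      have "(INF y. bary_functional \<mu> x1 y) \<le> bary_functional \<mu> x1 y"
        by (rule cINF_lower[OF bary_functional_bdd_below[OF assms]]) simp
      then show ?thesis using that shift[of x0 x x1] shift[of x0 y x1] by linarith
    qed
    then have "bary_functional \<mu> x0 x - \<epsilon> \<le> (INF y. bary_functional \<mu> x0 y)"
      by (intro cINF_greatest) auto
    then show ?thesis by simp
  qed
  then show ?thesis by (auto simp: barycentric_set_def)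
qed

text \<open>In a separable space a Borel probability measure is carried by its support. Without
  separability this cannot be proved (it is tied to the absence of real-valued measurable
  cardinals), and the support may even be empty.\<close>

lemma emeasure_msupport:
  fixes \<mu> :: "'a::{metric_space, second_countable_topology} measure"
  assumes "prob_space \<mu>" "sets \<mu> = sets borel"
  shows "emeasure \<mu> (msupport \<mu>) = 1"
proof -
  interpret prob_space \<mu> by fact
  define F where "F = {U. open U \<and> emeasure \<mu> U = 0}"
  have eq: "- msupport \<mu> = \<Union>F"
    by (auto simp: msupport_def F_def not_gr_zero)
  obtain G where G: "G \<subseteq> F" "countable G" "\<Union>G = \<Union>F"
    using Lindelof[of F] by (auto simp: F_def)
  have "\<Union>G \<in> null_sets \<mu>"
    using G(1,2) assms(2) by (intro null_sets_UN'[where N = id, simplified]) (auto simp: F_def null_sets_def)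
  then have "AE z in \<mu>. z \<in> msupport \<mu>"
    using G(3) eq by (auto dest!: AE_not_in elim!: eventually_mono)
  moreover have "msupport \<mu> \<in> events"
  proof -
    have "open (- msupport \<mu>)" unfolding eq by (auto simp: F_def)
    then have "closed (msupport \<mu>)" by (simp add: closed_def)
    then show ?thesis using assms(2) by simp
  qed
  ultimately show ?thesis by (simp add: emeasure_eq_measure prob_eq_1)
qed

end

theory Submission
  imports Defs
begin

text \<open>In a tree, the squared distance behaves as in a space of nonpositive curvature: it is
  2-convex along geodesics, and four points \<open>x, y, z, w\<close> satisfy Reshetnyak's inequality
  \<open>d(y,z)\<^sup>2 + d(x,w)\<^sup>2 \<le> d(x,z)\<^sup>2 + d(y,w)\<^sup>2 + 2 d(x,y) d(z,w)\<close>. Both follow from the triangle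
  inequality and the four-point condition, so in a \<open>\<delta>\<close>-hyperbolic space they persist up to an error
  of order \<open>\<delta>\<close> times the distances involved (\<open>dist_sq_almost_convex\<close> and
  \<open>reshetnyak_almost\<close>).

  Write \<open>L = d(x,y)\<close> and let \<open>C\<close> be the cost of a coupling of \<open>\<mu>\<close> and \<open>\<nu>\<close>. Moving \<open>x\<close> towards \<open>y\<close>
  by \<open>t L\<close> lowers the functional of \<open>\<mu>\<close> by at most \<open>\<epsilon>\<^sub>1\<close>, and moving \<open>y\<close> towards \<open>x\<close> by \<open>t L\<close> lowers
  that of \<open>\<nu>\<close> by at most \<open>\<epsilon>\<^sub>2\<close>. On the other hand, the two inequalities above, integrated against the
  coupling, show that the two decreases add up to at least
  \<open>2 t L ((1 - t) L - C) - (9 + 4 t) K\<close>, where \<open>K\<close> stands for \<open>\<delta> D\<^sub>2\<close>. With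
  \<open>t = (L - C) / (2 L)\<close> this becomes \<open>(L - C)\<^sup>2 \<le> 2 (\<epsilon>\<^sub>1 + \<epsilon>\<^sub>2) + 22 \<delta> D\<^sub>2\<close>
  (\<open>dist_le_coupling_cost\<close>). This is stronger than the claim: as \<open>8 \<delta> < L \<le> D\<^sub>2\<close>
  in the only case of interest, \<open>\<delta>\<close> is at most a third of \<open>sqrt ((D\<^sub>2 + \<delta>) \<delta>)\<close>.\<close>

section \<open>Comparison inequalities in hyperbolic spaces\<close>

lemma four_point_condition:
  fixes p q r s :: "'a::metric_space"
  assumes "delta_hyperbolic TYPE('a) \<delta>"
  shows "dist p q + dist r s \<le> max (dist p r + dist q s) (dist p s + dist q r) + 2 * \<delta>"
proof -
  have "gromov_product p r s \<ge> min (gromov_product p r q) (gromov_product p q s) - \<delta>"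
    using assms unfolding delta_hyperbolic_def by blast
  then show ?thesis
    by (auto simp: gromov_product_def min_def max_def dist_commute field_simps split: if_splits)
qed

lemma geodesic_space_intermediate_point:
  fixes x y :: "'a::metric_space"
  assumes "geodesic_space TYPE('a)" "0 \<le> t" "t \<le> 1"
  obtains m where "dist x m = t * dist x y" "dist y m = (1 - t) * dist x y"
proof -
  obtain \<gamma> where "minimal_geodesic \<gamma> x y"
    using assms(1) unfolding geodesic_space_def by blast
  then have \<gamma>: "\<gamma> 0 = x" "\<gamma> 1 = y"
    "\<And>s u. s \<in> {0..1} \<Longrightarrow> u \<in> {0..1} \<Longrightarrow> dist (\<gamma> s) (\<gamma> u) = \<bar>s - u\<bar> * dist x y"
    unfolding minimal_geodesic_def by auto
  show ?thesis
    using that[of "\<gamma> t"] \<gamma>(3)[of 0 t] \<gamma>(3)[of 1 t] assms(2,3) by (simp add: \<gamma>(1,2))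
qed

text \<open>By the four-point condition, the distance from \<open>z\<close> to \<open>m\<close> is up to \<open>2 \<delta>\<close> at most the larger of
  \<open>d(x,z) - t L\<close> and \<open>d(y,z) - (1 - t) L\<close>, where \<open>L = d(x,y)\<close>. The difference between the
  Euclidean right-hand side and the square of the first number is exactly
  \<open>t (d(y,z)\<^sup>2 - (d(x,z) - L)\<^sup>2)\<close>, which is nonnegative by the triangle inequality; the second
  number is symmetric. The bound \<open>K\<close> on \<open>\<delta>\<close> times distances, rather than a bound on distances,
  makes the estimate meaningful for \<open>\<delta> = 0\<close> on unbounded spaces.\<close>

lemma dist_sq_almost_convex:
  fixes x y z m :: "'a::metric_space"
  assumes hyp: "delta_hyperbolic TYPE('a) \<delta>" and "\<delta> \<ge> 0"
    and t: "0 \<le> t" "t \<le> 1"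
    and m: "dist x m = t * dist x y" "dist y m = (1 - t) * dist x y"
    and K: "\<delta> * dist x z \<le> K" "\<delta> * dist y z \<le> K" "8 * \<delta>\<^sup>2 \<le> K"
  shows "(dist m z)\<^sup>2 \<le> (1 - t) * (dist x z)\<^sup>2 + t * (dist y z)\<^sup>2 - t * (1 - t) * (dist x y)\<^sup>2
    + 9 / 2 * K"
proof -
  define L a b where "L = dist x y" and "a = dist x z" and "b = dist y z"
  have sq: "(dist m z)\<^sup>2 \<le> c\<^sup>2 + 9 / 2 * K" if "dist m z \<le> c + 2 * \<delta>" "\<delta> * c \<le> K" for c
  proof -
    have "(dist m z)\<^sup>2 \<le> (c + 2 * \<delta>)\<^sup>2"
      using that(1) by (intro power_mono) auto
    also have "\<dots> = c\<^sup>2 + 4 * (\<delta> * c) + 4 * \<delta>\<^sup>2"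
      by (simp add: power2_eq_square algebra_simps)
    finally show ?thesis using that(2) K(3) by linarith
  qed
  have L: "0 \<le> L" "0 \<le> t * L" "0 \<le> (1 - t) * L" using t by (auto simp: L_def)
  have "dist m z + L \<le> max (dist x m + b) (dist y m + a) + 2 * \<delta>"
    using four_point_condition[OF hyp, of m z x y]
    by (simp add: L_def a_def b_def dist_commute)
  then consider "dist m z \<le> (a - t * L) + 2 * \<delta>" | "dist m z \<le> (b - (1 - t) * L) + 2 * \<delta>"
    using m by (fastforce simp: L_def max_def algebra_simps split: if_splits)
  then show ?thesis
  proof cases
    case 1
    have "\<delta> * (a - t * L) \<le> \<delta> * a"
      using \<open>\<delta> \<ge> 0\<close> L by (intro mult_left_mono) auto
    then have *: "(dist m z)\<^sup>2 \<le> (a - t * L)\<^sup>2 + 9 / 2 * K"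
      using sq[OF 1] K(1) by (simp add: a_def)
    have "\<bar>a - L\<bar> \<le> b"
      using dist_triangle[of x z y] dist_triangle3[of x y z]
      by (simp add: a_def b_def L_def dist_commute abs_le_iff)
    then have "(a - L)\<^sup>2 \<le> b\<^sup>2" by (simp add: abs_le_square_iff[symmetric])
    then have "0 \<le> t * (b\<^sup>2 - (a - L)\<^sup>2)" using t by simp
    also have "\<dots> = (1 - t) * a\<^sup>2 + t * b\<^sup>2 - t * (1 - t) * L\<^sup>2 - (a - t * L)\<^sup>2"
      by (simp add: power2_eq_square algebra_simps)
    finally show ?thesis using * unfolding L_def a_def b_def by linarith
  next
    case 2
    have "\<delta> * (b - (1 - t) * L) \<le> \<delta> * b"
      using \<open>\<delta> \<ge> 0\<close> L by (intro mult_left_mono) auto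
    then have *: "(dist m z)\<^sup>2 \<le> (b - (1 - t) * L)\<^sup>2 + 9 / 2 * K"
      using sq[OF 2] K(2) by (simp add: b_def)
    have "\<bar>b - L\<bar> \<le> a"
      using dist_triangle[of y z x] dist_triangle3[of x y z]
      by (simp add: a_def b_def L_def dist_commute abs_le_iff)
    then have "(b - L)\<^sup>2 \<le> a\<^sup>2" by (simp add: abs_le_square_iff[symmetric])
    then have "0 \<le> (1 - t) * (a\<^sup>2 - (b - L)\<^sup>2)" using t by simp
    also have "\<dots> = (1 - t) * a\<^sup>2 + t * b\<^sup>2 - t * (1 - t) * L\<^sup>2 - (b - (1 - t) * L)\<^sup>2"
      by (simp add: power2_eq_square algebra_simps)
    finally show ?thesis using * unfolding L_def a_def b_def by linarith
  qed
qed

text \<open>The four-point condition bounds the pair sum \<open>d(y,z) + d(x,w)\<close> by one of the other two. If it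
  is bounded by \<open>d(x,z) + d(y,w)\<close>, then \<open>d(y,\<sqdot>) - d(x,\<sqdot>)\<close> is almost no larger at \<open>z\<close> than at \<open>w\<close>;
  multiply by \<open>d(x,\<sqdot>) + d(y,\<sqdot>)\<close>, which is 2-Lipschitz. If it is bounded by \<open>d(x,y) + d(z,w)\<close>, then
  \<open>d(x,z) \<ge> \<bar>d(y,z) - d(x,y)\<bar>\<close> and \<open>d(y,w) \<ge> \<bar>d(x,w) - d(x,y)\<bar>\<close> suffice.\<close>

lemma reshetnyak_almost:
  fixes x y z w :: "'a::metric_space"
  assumes hyp: "delta_hyperbolic TYPE('a) \<delta>" and "\<delta> \<ge> 0"
    and K: "\<delta> * dist x y \<le> K" "\<delta> * dist x w \<le> K" "\<delta> * dist y w \<le> K"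
  shows "(dist y z)\<^sup>2 + (dist x w)\<^sup>2
    \<le> (dist x z)\<^sup>2 + (dist y w)\<^sup>2 + 2 * dist x y * dist z w + 4 * K"
proof -
  define L r a b c e where "L = dist x y" and "r = dist z w" and "a = dist x z" and "b = dist y z"
    and "c = dist x w" and "e = dist y w"
  note defs = L_def r_def a_def b_def c_def e_def
  have "b + c \<le> max (L + r) (a + e) + 2 * \<delta>"
    using four_point_condition[OF hyp, of y z x w] by (simp add: defs dist_commute)
  then consider "b - a \<le> (e - c) + 2 * \<delta>" | "b + c \<le> L + r + 2 * \<delta>"
    by (fastforce simp: max_def split: if_splits)
  then have "b\<^sup>2 + c\<^sup>2 \<le> a\<^sup>2 + e\<^sup>2 + 2 * L * r + 4 * K"
  proof cases
    case 1
    have "\<bar>b - a\<bar> \<le> L"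
      using dist_triangle[of y z x] dist_triangle[of x z y]
      by (simp add: defs dist_commute abs_le_iff)
    moreover have "\<bar>(a + b) - (c + e)\<bar> \<le> 2 * r"
      using dist_triangle[of x z w] dist_triangle[of x w z] dist_triangle[of y z w]
        dist_triangle[of y w z]
      by (simp add: defs dist_commute abs_le_iff)
    ultimately have "\<bar>b - a\<bar> * \<bar>(a + b) - (c + e)\<bar> \<le> L * (2 * r)"
      by (intro mult_mono) auto
    then have "(b - a) * ((a + b) - (c + e)) \<le> L * (2 * r)"
      by (simp add: abs_mult[symmetric])
    moreover have "(b - a - (e - c)) * (c + e) \<le> (2 * \<delta>) * (c + e)"
      using 1 by (intro mult_right_mono) (auto simp: defs)
    moreover have "(2 * \<delta>) * (c + e) \<le> 4 * K"
      using K by (simp add: defs algebra_simps)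
    moreover have "b\<^sup>2 + c\<^sup>2 - a\<^sup>2 - e\<^sup>2
        = (b - a) * ((a + b) - (c + e)) + (b - a - (e - c)) * (c + e)"
      by (simp add: power2_eq_square algebra_simps)
    ultimately show ?thesis by linarith
  next
    case 2
    have "\<bar>b - L\<bar> \<le> a" "\<bar>c - L\<bar> \<le> e"
      using dist_triangle[of x y z] dist_triangle[of y z x] dist_triangle[of x y w]
        dist_triangle[of x w y]
      by (simp_all add: defs dist_commute abs_le_iff)
    then have "(b - L)\<^sup>2 \<le> a\<^sup>2" "(c - L)\<^sup>2 \<le> e\<^sup>2"
      by (simp_all add: abs_le_square_iff[symmetric])
    then have "b\<^sup>2 + c\<^sup>2 \<le> a\<^sup>2 + e\<^sup>2 + 2 * (L * (b + c - L))"
      by (simp add: power2_eq_square algebra_simps)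
    moreover have "L * (b + c - L) \<le> L * (r + 2 * \<delta>)"
      using 2 by (intro mult_left_mono) (auto simp: defs)
    moreover have "L * (r + 2 * \<delta>) \<le> L * r + 2 * K"
      using K(1) by (simp add: defs algebra_simps)
    ultimately show ?thesis by linarith
  qed
  then show ?thesis by (simp add: defs)
qed

section \<open>Variation of the two functionals along a geodesic\<close>

text \<open>The functional of \<open>\<mu>\<close> based at the competitor \<open>m\<close> vanishes at \<open>m\<close>, so its infimum is at most \<open>0\<close>.\<close>

lemma barycentric_set_integral_le:
  fixes \<mu> :: "'a::metric_space measure"
  assumes "\<mu> \<in> P1" "x \<in> barycentric_set \<mu> \<epsilon>"
  shows "(\<integral>z. ((dist x z)\<^sup>2 - (dist m z)\<^sup>2) \<partial>\<mu>) \<le> \<epsilon>"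
proof -
  have "bary_functional \<mu> m x \<le> (INF y. bary_functional \<mu> m y) + \<epsilon>"
    using barycentric_set_iff[OF assms(1)] assms(2) by blast
  also have "(INF y. bary_functional \<mu> m y) \<le> bary_functional \<mu> m m"
    by (rule cINF_lower[OF bary_functional_bdd_below[OF assms(1)]]) simp
  also have "bary_functional \<mu> m m = 0"
    by (simp add: bary_functional_def)
  finally show ?thesis by (simp add: bary_functional_def)
qed

text \<open>Here the points \<open>m\<close> and \<open>n\<close> lie at distance \<open>t d(x,y)\<close> from \<open>x\<close> and from \<open>y\<close> respectively,
  on the way to the other point.\<close>

lemma two_sided_variation_lower_bound:
  fixes x y z w m n :: "'a::metric_space"
  assumes hyp: "delta_hyperbolic TYPE('a) \<delta>" "\<delta> \<ge> 0"
    and t: "0 \<le> t" "t \<le> 1"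
    and m: "dist x m = t * dist x y" "dist y m = (1 - t) * dist x y"
    and n: "dist y n = t * dist x y" "dist x n = (1 - t) * dist x y"
    and K: "\<delta> * dist x y \<le> K" "8 * \<delta>\<^sup>2 \<le> K"
    and Kz: "\<delta> * dist x z \<le> K" "\<delta> * dist y z \<le> K"
    and Kw: "\<delta> * dist x w \<le> K" "\<delta> * dist y w \<le> K"
  shows "2 * t * (1 - t) * (dist x y)\<^sup>2 - (9 + 4 * t) * K - 2 * t * dist x y * dist z w
    \<le> ((dist x z)\<^sup>2 - (dist m z)\<^sup>2) + ((dist y w)\<^sup>2 - (dist n w)\<^sup>2)"
proof -
  note dist_sq_almost_convex[OF hyp t m Kz K(2)]
  moreover have "(dist n w)\<^sup>2 \<le> (1 - t) * (dist y w)\<^sup>2 + t * (dist x w)\<^sup>2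
      - t * (1 - t) * (dist x y)\<^sup>2 + 9 / 2 * K"
    using dist_sq_almost_convex[OF hyp t, of y n x w K] n Kw K(2) by (simp add: dist_commute)
  moreover have "t * ((dist y z)\<^sup>2 + (dist x w)\<^sup>2)
      \<le> t * ((dist x z)\<^sup>2 + (dist y w)\<^sup>2 + 2 * dist x y * dist z w + 4 * K)"
    using reshetnyak_almost[OF hyp K(1) Kw] t by (intro mult_left_mono)
  ultimately show ?thesis by (simp add: algebra_simps)
qed

section \<open>Integration against a coupling\<close>

lemma coupling_measurable:
  fixes \<pi> :: "('a::metric_space \<times> 'a) measure"
  assumes "\<pi> \<in> couplings \<mu> \<nu>"
  shows "fst \<in> \<pi> \<rightarrow>\<^sub>M borel" "snd \<in> \<pi> \<rightarrow>\<^sub>M borel"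
proof -
  have s: "sets \<pi> = sets borel" using assms by (simp add: couplings_def)
  show "fst \<in> \<pi> \<rightarrow>\<^sub>M borel" "snd \<in> \<pi> \<rightarrow>\<^sub>M borel"
    unfolding measurable_cong_sets[OF s refl]
    by (intro borel_measurable_continuous_onI continuous_intros)+
qed

lemma integrable_coupling_dist:
  fixes \<mu> \<nu> :: "'a::metric_space measure"
  assumes P: "\<mu> \<in> P1" "\<nu> \<in> P1" and \<pi>: "\<pi> \<in> couplings \<mu> \<nu>"
  shows "integrable \<pi> (\<lambda>p. dist (fst p) (snd p))"
proof -
  fix b :: 'a
  have s: "sets \<pi> = sets borel" and d: "distr \<pi> borel fst = \<mu>" "distr \<pi> borel snd = \<nu>"
    using \<pi> by (auto simp: couplings_def)
  have m: "(\<lambda>p. dist (fst p) (snd p)) \<in> borel_measurable \<pi>"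
    unfolding measurable_cong_sets[OF s refl]
    by (intro borel_measurable_continuous_onI continuous_intros)
  have "integrable \<pi> (\<lambda>p. dist b (fst p) + dist b (snd p))"
    using P1_integrable_dist[OF P(1), of b] P1_integrable_dist[OF P(2), of b]
    unfolding d[symmetric]
    by (intro Bochner_Integration.integrable_add integrable_distr[OF coupling_measurable(1)[OF \<pi>]]
        integrable_distr[OF coupling_measurable(2)[OF \<pi>]])
  then show ?thesis
    by (rule Bochner_Integration.integrable_bound[OF _ m]) (simp add: dist_triangle3)
qed

text \<open>The assumption \<open>8 \<delta> \<le> d(x,y)\<close> absorbs the quadratic error term: it gives
  \<open>8 \<delta>\<^sup>2 \<le> \<delta> d(x,y) \<le> K\<close>.\<close>

lemma dist_le_coupling_cost:
  fixes \<mu> \<nu> :: "'a::metric_space measure"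
  assumes hyp: "delta_hyperbolic TYPE('a) \<delta>" "\<delta> \<ge> 0" and geo: "geodesic_space TYPE('a)"
    and P: "\<mu> \<in> P1" "\<nu> \<in> P1"
    and bary: "x \<in> barycentric_set \<mu> \<epsilon>\<^sub>1" "y \<in> barycentric_set \<nu> \<epsilon>\<^sub>2"
    and K: "\<delta> * dist x y \<le> K"
    and K\<mu>: "AE z in \<mu>. \<delta> * dist x z \<le> K \<and> \<delta> * dist y z \<le> K"
    and K\<nu>: "AE w in \<nu>. \<delta> * dist x w \<le> K \<and> \<delta> * dist y w \<le> K"
    and far: "8 * \<delta> \<le> dist x y"
    and \<pi>: "\<pi> \<in> couplings \<mu> \<nu>"
    and nonneg: "\<epsilon>\<^sub>1 \<ge> 0" "\<epsilon>\<^sub>2 \<ge> 0"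
  shows "dist x y \<le> (\<integral>p. dist (fst p) (snd p) \<partial>\<pi>) + sqrt (22 * K + 2 * (\<epsilon>\<^sub>1 + \<epsilon>\<^sub>2))"
proof -
  define L C where "L = dist x y" and "C = (\<integral>p. dist (fst p) (snd p) \<partial>\<pi>)"
  have "8 * \<delta>\<^sup>2 \<le> \<delta> * L"
    using mult_left_mono[OF far \<open>\<delta> \<ge> 0\<close>] by (simp add: L_def power2_eq_square)
  then have K2: "8 * \<delta>\<^sup>2 \<le> K" using K by (simp add: L_def)
  then have "K \<ge> 0" using zero_le_power2[of \<delta>] by linarith
  have "C \<ge> 0" by (simp add: C_def)
  show ?thesis
  proof (cases "L \<le> C")
    case True
    have "0 \<le> sqrt (22 * K + 2 * (\<epsilon>\<^sub>1 + \<epsilon>\<^sub>2))"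
      using \<open>K \<ge> 0\<close> nonneg
      by (intro real_sqrt_ge_zero add_nonneg_nonneg mult_nonneg_nonneg) auto
    then show ?thesis using True unfolding L_def C_def by linarith
  next
    case False
    \<comment> \<open>This \<open>t\<close> maximises \<open>2 t L ((1 - t) L - C)\<close>.\<close>
    define t where "t = (L - C) / (2 * L)"
    have "L > 0" using False \<open>C \<ge> 0\<close> by simp
    have t: "0 \<le> t" "t \<le> 1" "t \<le> 1 / 2"
      using False \<open>C \<ge> 0\<close> \<open>L > 0\<close> by (auto simp: t_def field_simps)
    have tL: "2 * t * L = L - C" using \<open>L > 0\<close> by (simp add: t_def)
    obtain m where m: "dist x m = t * dist x y" "dist y m = (1 - t) * dist x y"
      using geodesic_space_intermediate_point[OF geo t(1,2)] by blast
    obtain n where n: "dist y n = t * dist x y" "dist x n = (1 - t) * dist x y"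
      using geodesic_space_intermediate_point[OF geo t(1,2), of y x] by (metis dist_commute)
    have d: "distr \<pi> borel fst = \<mu>" "distr \<pi> borel snd = \<nu>" and "prob_space \<pi>"
      using \<pi> by (auto simp: couplings_def)
    interpret prob_space \<pi> by fact
    note meas = coupling_measurable[OF \<pi>]
    define f g where "f = (\<lambda>z. (dist x z)\<^sup>2 - (dist m z)\<^sup>2)"
      and "g = (\<lambda>w. (dist y w)\<^sup>2 - (dist n w)\<^sup>2)"
    have fg_borel: "f \<in> borel_measurable borel" "g \<in> borel_measurable borel"
      unfolding f_def g_def by (intro borel_measurable_continuous_onI continuous_intros)+
    have "integrable \<mu> f" "integrable \<nu> g"
      unfolding f_def g_def by (intro P1_integrable_dist_sq_diff P)+
    then have int: "integrable \<pi> (\<lambda>p. f (fst p))" "integrable \<pi> (\<lambda>p. g (snd p))"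
      unfolding d[symmetric] by (auto intro: integrable_distr[OF meas(1)] integrable_distr[OF meas(2)])
    have eq: "(\<integral>p. f (fst p) \<partial>\<pi>) = (\<integral>z. f z \<partial>\<mu>)" "(\<integral>p. g (snd p) \<partial>\<pi>) = (\<integral>w. g w \<partial>\<nu>)"
      using integral_distr[OF meas(1) fg_borel(1)] integral_distr[OF meas(2) fg_borel(2)]
      by (simp_all add: d)
    have "AE p in \<pi>. \<delta> * dist x (fst p) \<le> K \<and> \<delta> * dist y (fst p) \<le> K"
      using AE_distrD[OF meas(1) K\<mu>[folded d(1)]] .
    moreover have "AE p in \<pi>. \<delta> * dist x (snd p) \<le> K \<and> \<delta> * dist y (snd p) \<le> K"
      using AE_distrD[OF meas(2) K\<nu>[folded d(2)]] .
    ultimately have ae: "AE p in \<pi>. 2 * t * (1 - t) * L\<^sup>2 - (9 + 4 * t) * K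
        - 2 * t * L * dist (fst p) (snd p) \<le> f (fst p) + g (snd p)"
    proof eventually_elim
      case (elim p)
      then show ?case
        using two_sided_variation_lower_bound[OF hyp t(1,2) m n K K2, of "fst p" "snd p"]
        by (simp add: f_def g_def L_def)
    qed
    note int_dist = integrable_coupling_dist[OF P \<pi>]
    have "2 * t * (1 - t) * L\<^sup>2 - (9 + 4 * t) * K - 2 * t * L * C
        = (\<integral>p. 2 * t * (1 - t) * L\<^sup>2 - (9 + 4 * t) * K
            - 2 * t * L * dist (fst p) (snd p) \<partial>\<pi>)"
      using int_dist by (simp add: C_def prob_space)
    also have "\<dots> \<le> (\<integral>p. f (fst p) + g (snd p) \<partial>\<pi>)"
      using int int_dist ae by (intro integral_mono_AE) auto
    also have "\<dots> = (\<integral>z. f z \<partial>\<mu>) + (\<integral>w. g w \<partial>\<nu>)"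
      using int by (simp add: eq)
    also have "\<dots> \<le> \<epsilon>\<^sub>1 + \<epsilon>\<^sub>2"
      unfolding f_def g_def using P bary by (intro add_mono barycentric_set_integral_le)
    finally have "2 * t * (1 - t) * L\<^sup>2 - (9 + 4 * t) * K - 2 * t * L * C \<le> \<epsilon>\<^sub>1 + \<epsilon>\<^sub>2" .
    moreover have "2 * t * (1 - t) * L\<^sup>2 - 2 * t * L * C = (L - C)\<^sup>2 / 2"
    proof -
      have "2 * t * (1 - t) * L\<^sup>2 - 2 * t * L * C = (2 * t * L) * ((L - C) - (2 * t * L) / 2)"
        by (simp add: power2_eq_square algebra_simps)
      also have "\<dots> = (L - C)\<^sup>2 / 2" unfolding tL by (simp add: power2_eq_square field_simps)
      finally show ?thesis .
    qed
    moreover have "(9 + 4 * t) * K \<le> 11 * K"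
      using t \<open>K \<ge> 0\<close> by (intro mult_right_mono) auto
    ultimately have "(L - C)\<^sup>2 \<le> 22 * K + 2 * (\<epsilon>\<^sub>1 + \<epsilon>\<^sub>2)" by (simp add: algebra_simps)
    then have "L - C \<le> sqrt (22 * K + 2 * (\<epsilon>\<^sub>1 + \<epsilon>\<^sub>2))" by (rule real_le_rsqrt)
    then show ?thesis unfolding L_def C_def by linarith
  qed
qed

section \<open>The estimate in terms of the Wasserstein distance\<close>

lemma dist_le_ediam:
  assumes "p \<in> A" "q \<in> A"
  shows "ennreal (dist p q) \<le> ediam A"
  unfolding ediam_def using assms by (intro SUP_upper2[of "(p, q)"]) auto

lemma ennsqrt_ennreal: "0 \<le> a \<Longrightarrow> ennsqrt (ennreal a) = ennreal (sqrt a)"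
  by (simp add: ennsqrt_def)

lemma le_W1_add:
  assumes "\<And>\<pi>. \<pi> \<in> couplings \<mu> \<nu> \<Longrightarrow> a \<le> (\<integral>\<^sup>+ p. ennreal (dist (fst p) (snd p)) \<partial>\<pi>) + R"
    and "a \<noteq> top"
  shows "a \<le> W1 \<mu> \<nu> + R"
proof -
  have "a - R \<le> W1 \<mu> \<nu>"
    unfolding W1_def using assms
    by (intro INF_greatest) (auto simp: ennreal_minus_le_iff add.commute)
  then show ?thesis using assms(2) by (auto simp: ennreal_minus_le_iff add.commute)
qed

theorem theorem4p5:
  fixes \<mu> \<nu> :: "'a::metric_space measure"
    and x y :: 'a
    and \<delta> \<epsilon>\<^sub>1 \<epsilon>\<^sub>2 :: real
    and D\<^sub>2 :: ennreal
  assumes "\<delta> \<ge> 0"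
    and "geodesic_space TYPE('a)"
    and "delta_hyperbolic TYPE('a) \<delta>"
    and "\<mu> \<in> P1" and "\<nu> \<in> P1"
    and "emeasure \<mu> (msupport \<mu>) = 1" and "emeasure \<nu> (msupport \<nu>) = 1"
    and "\<epsilon>\<^sub>1 \<ge> 0" and "\<epsilon>\<^sub>2 \<ge> 0"
    and "x \<in> barycentric_set \<mu> \<epsilon>\<^sub>1" and "y \<in> barycentric_set \<nu> \<epsilon>\<^sub>2"
  defines "D\<^sub>2 \<equiv> ediam ({x, y} \<union> msupport \<mu> \<union> msupport \<nu>)"
  shows "ennreal (dist x y) \<le> W1 \<mu> \<nu> +
    max (ennreal (8 * \<delta>))
        (ennsqrt (54 * D\<^sub>2 * ennsqrt (D\<^sub>2 + ennreal \<delta>) * ennsqrt (ennreal \<delta>)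
                  + ennreal (3 * (\<epsilon>\<^sub>1 + \<epsilon>\<^sub>2))))"
    (is "_ \<le> _ + max _ ?R")
proof (cases "dist x y \<le> 8 * \<delta>")
  case True
  then have "ennreal (dist x y) \<le> max (ennreal (8 * \<delta>)) ?R"
    by (simp add: le_max_iff_disj ennreal_leI)
  also have "\<dots> \<le> W1 \<mu> \<nu> + max (ennreal (8 * \<delta>)) ?R" by (rule add_increasing) simp_all
  finally show ?thesis .
next
  case False
  define S where "S = {x, y} \<union> msupport \<mu> \<union> msupport \<nu>"
  have D_ge: "ennreal (dist p q) \<le> D\<^sub>2" if "p \<in> S" "q \<in> S" for p q
    unfolding D\<^sub>2_def S_def[symmetric] using that by (rule dist_le_ediam)
  have sup: "AE z in \<mu>. z \<in> S" "AE w in \<nu>. w \<in> S"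
  proof -
    have ps: "prob_space \<mu>" "prob_space \<nu>" using assms(4,5) by (auto simp: P1_def)
    have "measure \<mu> (msupport \<mu>) = 1" "measure \<nu> (msupport \<nu>) = 1"
      unfolding measure_def assms(6,7) by simp_all
    then have "AE z in \<mu>. z \<in> msupport \<mu>" "AE w in \<nu>. w \<in> msupport \<nu>"
      by (simp_all add: prob_space.AE_prob_1[OF ps(1)] prob_space.AE_prob_1[OF ps(2)])
    then show "AE z in \<mu>. z \<in> S" "AE w in \<nu>. w \<in> S"
      by (auto simp: S_def elim!: eventually_mono)
  qed
  \<comment> \<open>For unbounded \<open>S\<close> and \<open>\<delta> = 0\<close>, where \<open>top * 0 = 0\<close> on the right-hand side, the bound \<open>K\<close> is \<open>0\<close>.\<close>
  have "?R = top \<or> (\<exists>K. (\<forall>p\<in>S. \<forall>q\<in>S. \<delta> * dist p q \<le> K) \<and>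
      ennreal (sqrt (22 * K + 2 * (\<epsilon>\<^sub>1 + \<epsilon>\<^sub>2))) \<le> ?R)"
  proof (cases "\<delta> = 0")
    case True
    have "?R = ennreal (sqrt (3 * (\<epsilon>\<^sub>1 + \<epsilon>\<^sub>2)))"
      using True assms(8,9) ennsqrt_ennreal[of 0]
      by (simp add: ennsqrt_ennreal del: distrib_left_numeral)
    then show ?thesis
      using True assms(8,9) by (intro disjI2 exI[of _ 0]) (auto intro!: ennreal_leI)
  next
    case \<delta>: False
    show ?thesis
    proof (cases "D\<^sub>2 = top")
      case True
      then have "?R = top"
        using \<delta> assms(1) by (simp add: ennsqrt_def ennreal_mult_eq_top_iff)
      then show ?thesis ..
    next
      case Dfin: False
      define D where "D = enn2real D\<^sub>2"
      have D: "D\<^sub>2 = ennreal D" "D \<ge> 0" using Dfin by (simp_all add: D_def top.not_eq_extremum)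
      have le_D: "dist p q \<le> D" if "p \<in> S" "q \<in> S" for p q
        using D_ge[OF that] D by simp
      have "8 * \<delta> \<le> D" using le_D[of x y] False by (simp add: S_def)
      have "3 * \<delta> \<le> sqrt ((D + \<delta>) * \<delta>)"
        using mult_right_mono[OF \<open>8 * \<delta> \<le> D\<close> assms(1)]
        by (intro real_le_rsqrt) (simp add: power2_eq_square algebra_simps)
      then have "3 * \<delta> \<le> sqrt (D + \<delta>) * sqrt \<delta>" by (simp add: real_sqrt_mult)
      then have "54 * D * (3 * \<delta>) \<le> 54 * D * (sqrt (D + \<delta>) * sqrt \<delta>)"
        using D(2) by (intro mult_left_mono) auto
      moreover have "22 * (\<delta> * D) \<le> 54 * D * (3 * \<delta>)"
        using assms(1) D(2) by simp
      ultimately have "22 * (\<delta> * D) \<le> 54 * D * sqrt (D + \<delta>) * sqrt \<delta>"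
        by (simp only: mult.assoc order.trans)
      then have "22 * (\<delta> * D) + 2 * (\<epsilon>\<^sub>1 + \<epsilon>\<^sub>2)
          \<le> 54 * D * sqrt (D + \<delta>) * sqrt \<delta> + 3 * (\<epsilon>\<^sub>1 + \<epsilon>\<^sub>2)"
        using assms(8,9) by (intro add_mono mult_right_mono) auto
      moreover have "?R = ennreal (sqrt (54 * D * sqrt (D + \<delta>) * sqrt \<delta> + 3 * (\<epsilon>\<^sub>1 + \<epsilon>\<^sub>2)))"
      proof -
        have "ennsqrt (D\<^sub>2 + ennreal \<delta>) = ennreal (sqrt (D + \<delta>))"
          using D assms(1) by (simp add: ennsqrt_ennreal flip: ennreal_plus)
        then have "54 * D\<^sub>2 * ennsqrt (D\<^sub>2 + ennreal \<delta>) * ennsqrt (ennreal \<delta>)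
            = ennreal (54 * D * sqrt (D + \<delta>) * sqrt \<delta>)"
          using D assms(1) by (simp add: ennsqrt_ennreal ennreal_mult)
        then show ?thesis
          using D assms(1,8,9)
          by (simp add: ennsqrt_ennreal del: distrib_left_numeral flip: ennreal_plus)
      qed
      ultimately show ?thesis
        using le_D assms(1)
        by (intro disjI2 exI[of _ "\<delta> * D"]) (auto intro!: mult_left_mono ennreal_leI)
    qed
  qed
  then show ?thesis
  proof
    assume "?R = top"
    then show ?thesis by simp
  next
    assume "\<exists>K. (\<forall>p\<in>S. \<forall>q\<in>S. \<delta> * dist p q \<le> K) \<and>
      ennreal (sqrt (22 * K + 2 * (\<epsilon>\<^sub>1 + \<epsilon>\<^sub>2))) \<le> ?R"
    then obtain K where K: "\<And>p q. p \<in> S \<Longrightarrow> q \<in> S \<Longrightarrow> \<delta> * dist p q \<le> K"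
      and KR: "ennreal (sqrt (22 * K + 2 * (\<epsilon>\<^sub>1 + \<epsilon>\<^sub>2))) \<le> ?R" by blast
    have xy: "x \<in> S" "y \<in> S" by (auto simp: S_def)
    have "ennreal (dist x y) \<le> W1 \<mu> \<nu> + ?R"
    proof (rule le_W1_add)
      fix \<pi> assume \<pi>: "\<pi> \<in> couplings \<mu> \<nu>"
      let ?C = "\<integral>p. dist (fst p) (snd p) \<partial>\<pi>"
      have "dist x y \<le> ?C + sqrt (22 * K + 2 * (\<epsilon>\<^sub>1 + \<epsilon>\<^sub>2))"
        using sup False xy K
        by (intro dist_le_coupling_cost[OF assms(3,1,2,4,5,10,11) _ _ _ _ \<pi> assms(8,9)])
          (auto elim!: eventually_mono)
      moreover have "K \<ge> 0" using K[OF xy(1) xy(1)] by simp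
      ultimately have "ennreal (dist x y)
          \<le> ennreal ?C + ennreal (sqrt (22 * K + 2 * (\<epsilon>\<^sub>1 + \<epsilon>\<^sub>2)))"
        using assms(8,9) by (simp add: ennreal_leI flip: ennreal_plus)
      also have "ennreal ?C = (\<integral>\<^sup>+ p. ennreal (dist (fst p) (snd p)) \<partial>\<pi>)"
        by (intro nn_integral_eq_integral[symmetric] integrable_coupling_dist[OF assms(4,5) \<pi>]) auto
      also note add_left_mono[OF KR]
      finally show "ennreal (dist x y) \<le> (\<integral>\<^sup>+ p. ennreal (dist (fst p) (snd p)) \<partial>\<pi>) + ?R" .
    qed simp
    also have "\<dots> \<le> W1 \<mu> \<nu> + max (ennreal (8 * \<delta>)) ?R" by (intro add_left_mono) simp
    finally show ?thesis .
  qed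
qed

end
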